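(* For every (non-degenerate) triangle in the Euclidean plane with circumradius $R$, and for the radius $r$ of any one of its three excircles, one has $R/r > 1/4$.
   Context: An excircle of a triangle is a circle outside the triangle that is tangent to one side and to the extensions of the other two sides. If the side lengths are $f,g,h$, $s=(f+g+h)/2$, and $r$ is the radius of the excircle touching the side $h$ from outside, then $R=\frac{fgh}{4\Delta}$ and $r=\sqrt{\frac{s(s-f)(s-g)}{s-h}}$, where $\Delta=\sqrt{s(s-f)(s-g)(s-h)}$ is the area. *)

theory Defs
  imports "HOL-Analysis.Analysis"
begin

definition is_circumcircle ::
  "real^2 \<Rightarrow> real^2 \<Rightarrow> real^2 \<Rightarrow> real^2 \<Rightarrow> real \<Rightarrow> bool" where
  "is_circumcircle A B C c R \<longleftrightarrow> {A, B, C} \<subseteq> sphere c R"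

text \<open>The line \<open>AB\<close> is tangent at \<open>T\<close> to the circle with centre \<open>c\<close> and radius \<open>r\<close>.
  This is meant for \<open>A \<noteq> B\<close> and \<open>r > 0\<close>.\<close>
definition tangent_line_at ::
  "real^2 \<Rightarrow> real^2 \<Rightarrow> real^2 \<Rightarrow> real \<Rightarrow> real^2 \<Rightarrow> bool" where
  "tangent_line_at A B c r T \<longleftrightarrow> affine hull {A, B} \<inter> sphere c r = {T}"

definition tangent_to_side :: "real^2 \<Rightarrow> real^2 \<Rightarrow> real^2 \<Rightarrow> real \<Rightarrow> bool" where
  "tangent_to_side A B c r \<longleftrightarrow> (\<exists>T \<in> closed_segment A B. tangent_line_at A B c r T)"

definition tangent_to_extension :: "real^2 \<Rightarrow> real^2 \<Rightarrow> real^2 \<Rightarrow> real \<Rightarrow> bool" where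
  "tangent_to_extension A B c r \<longleftrightarrow>
     (\<exists>T \<in> affine hull {A, B} - closed_segment A B. tangent_line_at A B c r T)"

text \<open>The excircle of the triangle \<open>ABC\<close> touching the side \<open>AB\<close>. The closed disc still meets the
  boundary of the triangle, at its point of contact with \<open>AB\<close>; hence \<open>interior\<close> below.\<close>
definition is_excircle_at ::
  "real^2 \<Rightarrow> real^2 \<Rightarrow> real^2 \<Rightarrow> real^2 \<Rightarrow> real \<Rightarrow> bool" where
  "is_excircle_at A B C c r \<longleftrightarrow>
     r > 0 \<and>
     cball c r \<inter> interior (convex hull {A, B, C}) = {} \<and>
     tangent_to_side A B c r \<and>
     tangent_to_extension B C c r \<and>
     tangent_to_extension C A c r"

definition is_excircle ::
  "real^2 \<Rightarrow> real^2 \<Rightarrow> real^2 \<Rightarrow> real^2 \<Rightarrow> real \<Rightarrow> bool" where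
  "is_excircle A B C c r \<longleftrightarrow>
     is_excircle_at A B C c r \<or> is_excircle_at B C A c r \<or> is_excircle_at C A B c r"

end

theory Submission
  imports Defs
begin

text \<open>Let the excircle touch the side \<open>AB\<close> of length \<open>h\<close>, at distances \<open>p\<close> from \<open>A\<close> and \<open>q\<close> from
  \<open>B\<close>, and let \<open>t\<close> be the tangent length from \<open>C\<close>. Equality of tangent lengths gives
  \<open>t = |BC| + q = |CA| + p\<close> and \<open>h = p + q\<close>, so that \<open>t = s\<close>, \<open>q = s - |BC|\<close> and \<open>p = s - |CA|\<close>.
  With \<open>z = s - h\<close> the two radii satisfy \<open>r\<^sup>2 z = t p q\<close> and
  \<open>16 R\<^sup>2 t z p q = (|BC| |CA| |AB|)\<^sup>2\<close>, and the claim reduces to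
  \<open>(q + z + p) p q < (p + z) (q + z) (p + q)\<close>.\<close>

section \<open>Tangent lines and tangent lengths\<close>

lemma tangent_line_at_orthogonal:
  assumes "tangent_line_at A B c r T" "A \<noteq> B"
  shows "(c - T) \<bullet> (B - A) = 0" "dist c T = r" "\<exists>l. T = A + l *\<^sub>R (B - A)"
proof -
  let ?u = "B - A"
  have T: "T \<in> affine hull {A, B}" "T \<in> sphere c r"
    using assms(1) unfolding tangent_line_at_def by auto
  show rT: "dist c T = r" using T(2) by simp
  obtain l where l: "T = A + l *\<^sub>R ?u"
    using T(1) unfolding affine_hull_2_alt by auto
  then show "\<exists>l. T = A + l *\<^sub>R ?u" by blast
  have uu: "?u \<bullet> ?u \<noteq> 0" using assms(2) by simp
  \<comment> \<open>The reflection of \<open>T\<close> in the foot of the perpendicular from \<open>c\<close> is again a common point.\<close>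
  define m where "m = 2 * ((c - T) \<bullet> ?u) / (?u \<bullet> ?u)"
  define S where "S = T + m *\<^sub>R ?u"
  have mu: "m * (?u \<bullet> ?u) = 2 * ((c - T) \<bullet> ?u)" using uu by (simp add: m_def)
  have "S = A + (l + m) *\<^sub>R ?u" by (simp add: S_def l scaleR_add_left)
  then have 1: "S \<in> affine hull {A, B}" unfolding affine_hull_2_alt by blast
  have "c - S = (c - T) - m *\<^sub>R ?u" by (simp add: S_def)
  then have "(norm (c - S))\<^sup>2 = (norm (c - T))\<^sup>2 - 2 * m * ((c - T) \<bullet> ?u) + m * (m * (?u \<bullet> ?u))"
    unfolding power2_norm_eq_inner
    by (simp only: inner_diff_left inner_diff_right inner_scaleR_left inner_scaleR_right
        inner_commute[of ?u]) (simp add: algebra_simps inner_commute)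
  also have "\<dots> = (norm (c - T))\<^sup>2" unfolding mu by simp
  finally have "dist c S = r" using rT by (simp add: dist_norm)
  with 1 have "S \<in> affine hull {A, B} \<inter> sphere c r" by simp
  with assms(1) have "S = T" unfolding tangent_line_at_def by blast
  then have "m = 0" using assms(2) by (simp add: S_def)
  then show "(c - T) \<bullet> ?u = 0" using uu by (simp add: m_def)
qed

text \<open>Pythagoras in the right triangle with vertices \<open>A\<close> (or \<open>B\<close>),
  \<open>T\<close> and \<open>c\<close>. The right-hand sides do not mention \<open>T\<close>, so
  both tangents from a vertex get literally the same expression for their length.\<close>

lemma tangent_length:
  assumes "tangent_line_at A B c r T" "A \<noteq> B"
  shows "(dist A T)\<^sup>2 = (dist A c)\<^sup>2 - r\<^sup>2" "(dist B T)\<^sup>2 = (dist B c)\<^sup>2 - r\<^sup>2"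
proof -
  note tan = tangent_line_at_orthogonal[OF assms]
  obtain l where l: "T = A + l *\<^sub>R (B - A)" using tan(3) by blast
  have pyth: "(dist P T)\<^sup>2 = (dist P c)\<^sup>2 - r\<^sup>2" if "P - T = k *\<^sub>R (B - A)" for P k
  proof -
    have "orthogonal (P - T) (T - c)"
      using tan(1) unfolding that orthogonal_def
      by (simp add: inner_diff_left inner_diff_right inner_commute)
    from norm_add_Pythagorean[OF this] show ?thesis
      using tan(2) by (simp add: dist_norm norm_minus_commute)
  qed
  have "A - T = (- l) *\<^sub>R (B - A)" by (simp add: l)
  then show "(dist A T)\<^sup>2 = (dist A c)\<^sup>2 - r\<^sup>2" by (rule pyth)
  have "B - T = (1 - l) *\<^sub>R (B - A)" by (simp add: l scaleR_diff_left)
  then show "(dist B T)\<^sup>2 = (dist B c)\<^sup>2 - r\<^sup>2" by (rule pyth)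
qed

lemma tangent_to_side_length:
  assumes "tangent_to_side A B c r" "A \<noteq> B"
  shows "sqrt ((dist A c)\<^sup>2 - r\<^sup>2) + sqrt ((dist B c)\<^sup>2 - r\<^sup>2) = dist A B"
proof -
  obtain T where T: "T \<in> closed_segment A B" "tangent_line_at A B c r T"
    using assms(1) unfolding tangent_to_side_def by blast
  have "dist A B = dist A T + dist T B"
    using T(1) by (simp add: between_mem_segment[symmetric] between)
  then show ?thesis
    using tangent_length[OF T(2) assms(2), symmetric] by (simp add: dist_commute)
qed

text \<open>The contact point lies beyond \<open>P\<close> in the first case and beyond
  \<open>Q\<close> in the second. It is also the foot of the perpendicular from \<open>c\<close>,
  which gives the inner product at the vertex farther from it.\<close>

lemma tangent_to_extension_cases:
  assumes "tangent_to_extension P Q c r" "P \<noteq> Q"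
  obtains
    "sqrt ((dist Q c)\<^sup>2 - r\<^sup>2) = dist P Q + sqrt ((dist P c)\<^sup>2 - r\<^sup>2)"
    "(c - Q) \<bullet> (P - Q) = sqrt ((dist Q c)\<^sup>2 - r\<^sup>2) * dist P Q"
  | "sqrt ((dist P c)\<^sup>2 - r\<^sup>2) = dist P Q + sqrt ((dist Q c)\<^sup>2 - r\<^sup>2)"
    "(c - P) \<bullet> (Q - P) = sqrt ((dist P c)\<^sup>2 - r\<^sup>2) * dist P Q"
proof -
  obtain T where T: "T \<notin> closed_segment P Q" "tangent_line_at P Q c r T"
    using assms(1) unfolding tangent_to_extension_def by blast
  note tan = tangent_line_at_orthogonal[OF T(2) assms(2)]
  obtain l where l: "T = P + l *\<^sub>R (Q - P)" using tan(3) by blast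
  have out: "l < 0 \<or> l > 1"
  proof (rule ccontr)
    assume "\<not> ?thesis"
    moreover have "T = (1 - l) *\<^sub>R P + l *\<^sub>R Q" by (simp add: l algebra_simps)
    ultimately have "T \<in> closed_segment P Q"
      unfolding closed_segment_def by (intro CollectI exI[of _ l]) simp
    with T(1) show False by contradiction
  qed
  have lenP: "sqrt ((dist P c)\<^sup>2 - r\<^sup>2) = \<bar>l\<bar> * dist P Q"
  proof -
    have "P - T = (- l) *\<^sub>R (Q - P)" by (simp add: l)
    then have "dist P T = \<bar>l\<bar> * dist P Q" by (simp add: dist_norm norm_minus_commute)
    then show ?thesis using tangent_length(1)[OF T(2) assms(2), symmetric] by simp
  qed
  have lenQ: "sqrt ((dist Q c)\<^sup>2 - r\<^sup>2) = \<bar>1 - l\<bar> * dist P Q"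
  proof -
    have "Q - T = (1 - l) *\<^sub>R (Q - P)" by (simp add: l scaleR_diff_left)
    then have "dist Q T = \<bar>1 - l\<bar> * dist P Q" by (simp add: dist_norm norm_minus_commute)
    then show ?thesis using tangent_length(2)[OF T(2) assms(2), symmetric] by simp
  qed
  have sq: "(Q - P) \<bullet> (Q - P) = dist P Q * dist P Q"
    by (metis dist_commute dist_norm power2_eq_square power2_norm_eq_inner)
  have "c - P = (c - T) + l *\<^sub>R (Q - P)" by (simp add: l)
  then have innP: "(c - P) \<bullet> (Q - P) = l * (dist P Q * dist P Q)"
    using tan(1) sq by (simp only: inner_add_left inner_scaleR_left)
  have "c - Q = (c - T) + (l - 1) *\<^sub>R (Q - P)" by (simp add: l scaleR_diff_left)
  then have "(c - Q) \<bullet> (Q - P) = (l - 1) * (dist P Q * dist P Q)"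
    using tan(1) sq by (simp only: inner_add_left inner_scaleR_left)
  then have innQ: "(c - Q) \<bullet> (P - Q) = (1 - l) * (dist P Q * dist P Q)"
    by (simp add: inner_diff_right algebra_simps)
  from out show thesis
  proof
    assume "l < 0"
    then show thesis
      using that(1) lenP lenQ innQ by (simp add: algebra_simps)
  next
    assume "l > 1"
    then show thesis
      using that(2) lenP lenQ innP by (simp add: algebra_simps)
  qed
qed

section \<open>Inner products in the plane\<close>

text \<open>Three vectors of the plane are linearly dependent, so the Gram determinant of
  \<open>w\<close>, \<open>a\<close>, \<open>b\<close> vanishes. This recovers the length of
  \<open>w\<close> from its inner products with two sides, and serves for both centres.\<close>

lemma gram_expansion_2:
  fixes a b w :: "real^2"
  shows "(w \<bullet> w) * ((a \<bullet> a) * (b \<bullet> b) - (a \<bullet> b)\<^sup>2) =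
    (w \<bullet> a)\<^sup>2 * (b \<bullet> b) - 2 * (w \<bullet> a) * (w \<bullet> b) * (a \<bullet> b) + (w \<bullet> b)\<^sup>2 * (a \<bullet> a)"
  by (simp add: inner_vec_def sum_2) algebra

text \<open>A point equidistant from \<open>P\<close> and \<open>Q\<close> projects to the midpoint
  of the segment.\<close>

lemma inner_circumcentre:
  assumes "dist x P = R" "dist x Q = R"
  shows "2 * ((x - Q) \<bullet> (P - Q)) = (dist P Q)\<^sup>2"
proof -
  have "(x - P) \<bullet> (x - P) = (x - Q) \<bullet> (x - Q)"
    using assms by (metis dist_norm power2_norm_eq_inner)
  then show ?thesis
    by (simp add: dist_norm power2_norm_eq_inner inner_diff_left inner_diff_right inner_commute)
qed

text \<open>With side lengths \<open>p + z\<close>, \<open>q + z\<close>, \<open>p + q\<close> the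
  semiperimeter is \<open>t\<close>; \<open>exc\<close> and \<open>circ\<close> are then the
  classical formulas for exradius and circumradius, squared and cleared of denominators.\<close>

lemma excircle_radius_lt_aux:
  fixes R r t p q z :: real
  assumes "0 \<le> p" "0 \<le> q" "0 < z" "0 < r" "0 \<le> R" "t = p + q + z"
    and exc: "r\<^sup>2 * z = t * p * q"
    and circ: "16 * R\<^sup>2 * (t * z * p * q) = ((p + z) * (q + z) * (p + q))\<^sup>2"
  shows "r < 4 * R"
proof -
  \<comment> \<open>Positivity of \<open>r\<^sup>2 * z\<close> excludes contact at a vertex, that
    is, \<open>p = 0\<close> or \<open>q = 0\<close>.\<close>
  have "0 < t * p * q" using exc assms(3,4) by (metis mult_pos_pos zero_less_power)
  then have pq: "0 < p" "0 < q" using assms(1,2) by (auto simp: less_le)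
  have "0 < t" using pq assms by simp
  have "(p + z) * (q + z) * (p + q) - t * p * q = p\<^sup>2*z + q\<^sup>2*z + p*q*z + z\<^sup>2*p + z\<^sup>2*q"
    unfolding assms(6) by algebra
  also have "\<dots> > 0" using pq assms(3) by (intro add_pos_pos mult_pos_pos zero_less_power)
  \<comment> \<open>After squaring, \<open>exc\<close> and \<open>circ\<close> exhibit the common
    factor \<open>z * (t * p * q)\<close>, which cancels.\<close>
  finally have "(t * p * q)\<^sup>2 < ((p + z) * (q + z) * (p + q))\<^sup>2"
    using \<open>0 < t * p * q\<close> by (intro power_strict_mono) auto
  also have "\<dots> = (4 * R)\<^sup>2 * z * (t * p * q)" using circ by (simp add: algebra_simps)
  finally have "r\<^sup>2 * z * (t * p * q) < (4 * R)\<^sup>2 * z * (t * p * q)"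
    unfolding exc by (simp add: power2_eq_square)
  then have "r\<^sup>2 * z < (4 * R)\<^sup>2 * z" using \<open>0 < t * p * q\<close> mult_less_cancel_right_pos by blast
  then have "r\<^sup>2 < (4 * R)\<^sup>2" using assms(3) mult_less_cancel_right_pos by blast
  then show ?thesis using assms(5) by (intro power_less_imp_less_base[of r 2]) auto
qed

section \<open>Both radii in terms of tangent lengths\<close>

lemma excircle_at_radius_lt:
  assumes nc: "\<not> collinear {A, B, C}"
    and cc: "is_circumcircle A B C x R"
    and ex: "is_excircle_at A B C c r"
  shows "r < 4 * R"
proof -
  define f where "f = dist B C"
  define g where "g = dist C A"
  define h where "h = dist A B"
  define p where "p = sqrt ((dist A c)\<^sup>2 - r\<^sup>2)"
  define q where "q = sqrt ((dist B c)\<^sup>2 - r\<^sup>2)"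
  define t where "t = sqrt ((dist C c)\<^sup>2 - r\<^sup>2)"
  define a where "a = A - C"
  define b where "b = B - C"
  define k where "k = a \<bullet> b"
  have ne: "A \<noteq> B" "B \<noteq> C" "C \<noteq> A"
    using nc by (auto simp: insert_commute)
  then have pos: "f > 0" "g > 0" by (simp_all add: f_def g_def)
  have ff: "b \<bullet> b = f\<^sup>2" and gg: "a \<bullet> a = g\<^sup>2"
    by (simp_all add: a_def b_def f_def g_def dist_norm power2_norm_eq_inner[symmetric]
        norm_minus_commute)
  have hh: "h\<^sup>2 = f\<^sup>2 + g\<^sup>2 - 2 * k"
  proof -
    have "h\<^sup>2 = (a - b) \<bullet> (a - b)"
      by (simp add: h_def a_def b_def dist_norm power2_norm_eq_inner)
    then show ?thesis
      by (simp add: inner_diff_left inner_diff_right inner_commute k_def flip: ff gg)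
  qed
  have "\<not> collinear {0, a, b}"
    using nc collinear_3[of A C B] by (simp add: a_def b_def insert_commute)
  then have "\<bar>k\<bar> \<noteq> norm a * norm b"
    using norm_cauchy_schwarz_equal[of a b] by (simp add: k_def)
  moreover have "norm a = g" "norm b = f"
    by (simp_all add: a_def b_def f_def g_def dist_norm norm_minus_commute)
  ultimately have "\<bar>k\<bar> < f * g"
    using Cauchy_Schwarz_ineq2[of a b] by (simp add: k_def mult.commute)
  \<comment> \<open>The product of these two numbers is four times the squared area; their
    positivity permits the later cancellation.\<close>
  then have kfg: "0 < f * g - k" "0 < f * g + k" by linarith+
  have "h\<^sup>2 < (f + g)\<^sup>2" using hh kfg by (simp add: power2_sum)
  then have tri: "h < f + g"
    using pos by (intro power_less_imp_less_base[of h 2]) auto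
  have r: "r > 0" and side: "tangent_to_side A B c r"
    and extB: "tangent_to_extension B C c r" and extA: "tangent_to_extension C A c r"
    using ex by (auto simp: is_excircle_at_def)
  have pq: "p + q = h"
    using tangent_to_side_length[OF side ne(1)] by (simp add: p_def q_def h_def)
  \<comment> \<open>\<open>sqrt\<close> is negative at negative arguments, so actual contact points
    are needed to see that the radicands are squares.\<close>
  obtain T where "tangent_line_at A B c r T" using side by (auto simp: tangent_to_side_def)
  note lenAB = tangent_length[OF this ne(1)]
  obtain U where "tangent_line_at B C c r U" using extB by (auto simp: tangent_to_extension_def)
  note lenC = tangent_length(2)[OF this ne(2)]
  have tt: "t\<^sup>2 = (dist C c)\<^sup>2 - r\<^sup>2" unfolding t_def lenC[symmetric] by simp
  have nonneg: "p \<ge> 0" "q \<ge> 0" "t \<ge> 0"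
    unfolding p_def q_def t_def lenAB[symmetric] lenC[symmetric] by simp_all
  \<comment> \<open>Contact on the far side of \<open>C\<close> would force \<open>h \<ge> f + g\<close>.\<close>
  have B: "(t = f + q \<and> (c - C) \<bullet> b = t * f) \<or> q = f + t"
    using tangent_to_extension_cases[OF extB ne(2)] by (metis b_def f_def q_def t_def)
  have A: "(t = g + p \<and> (c - C) \<bullet> a = t * g) \<or> p = g + t"
    using tangent_to_extension_cases[OF extA ne(3)] by (metis a_def g_def p_def t_def)
  have tB: "t = f + q" "(c - C) \<bullet> b = t * f" and tA: "t = g + p" "(c - C) \<bullet> a = t * g"
    using A B nonneg pq tri by auto
  define z where "z = t - h"
  have z: "t = p + q + z" "f = p + z" "g = q + z" "h = p + q"
    using tA tB pq by (simp_all add: z_def)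
  have z0: "0 < z" using z tri by simp
  \<comment> \<open>The law of cosines, factored as a difference of squares. Multiplying both
    equations yields Heron's formula.\<close>
  have k1: "f * g + k = 2 * t * z" and k2: "f * g - k = 2 * p * q"
    using hh unfolding z by algebra+
  have gram: "(w \<bullet> w) * ((f * g - k) * (f * g + k)) =
      (w \<bullet> a)\<^sup>2 * f\<^sup>2 - 2 * (w \<bullet> a) * (w \<bullet> b) * k + (w \<bullet> b)\<^sup>2 * g\<^sup>2" for w
    using gram_expansion_2[of w a b] unfolding ff gg k_def[symmetric] by algebra
  have exc: "r\<^sup>2 * z = t * p * q"
  proof -
    have "(c - C) \<bullet> (c - C) = t\<^sup>2 + r\<^sup>2"
      unfolding tt by (simp add: dist_norm norm_minus_commute power2_norm_eq_inner[symmetric])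
    then have "(t\<^sup>2 + r\<^sup>2) * ((f * g - k) * (f * g + k)) =
        (t * g)\<^sup>2 * f\<^sup>2 - 2 * (t * g) * (t * f) * k + (t * f)\<^sup>2 * g\<^sup>2"
      using gram[of "c - C"] unfolding tA(2) tB(2) by simp
    \<comment> \<open>The right-hand side above equals
      \<open>2 * t\<^sup>2 * f * g * (f * g - k)\<close>.\<close>
    then have "(f * g - k) * ((t\<^sup>2 + r\<^sup>2) * (f * g + k)) = (f * g - k) * (2 * t\<^sup>2 * f * g)"
      by algebra
    then have "(t\<^sup>2 + r\<^sup>2) * (f * g + k) = 2 * t\<^sup>2 * f * g" using kfg by simp
    \<comment> \<open>As \<open>k\<close> is \<open>f * g\<close> times the cosine of the angle at
      \<open>C\<close>, this says that \<open>r / t\<close> is the tangent of half that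
      angle.\<close>
    then have "r\<^sup>2 * (f * g + k) = t\<^sup>2 * (f * g - k)" by algebra
    then have "2 * t * (r\<^sup>2 * z) = 2 * t * (t * p * q)" unfolding k1 k2 by algebra
    moreover have "t > 0" using z z0 nonneg by simp
    ultimately show ?thesis by simp
  qed
  have xd: "dist x A = R" "dist x B = R" "dist x C = R"
    using cc by (auto simp: is_circumcircle_def)
  have circ: "16 * R\<^sup>2 * (t * z * p * q) = ((p + z) * (q + z) * (p + q))\<^sup>2"
  proof -
    have "(x - C) \<bullet> (x - C) = R\<^sup>2"
      using xd(3) by (simp add: dist_norm power2_norm_eq_inner[symmetric])
    moreover have "(x - C) \<bullet> a = g\<^sup>2 / 2" "(x - C) \<bullet> b = f\<^sup>2 / 2"
      using inner_circumcentre[OF xd(1,3)] inner_circumcentre[OF xd(2,3)]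
      by (simp_all add: a_def b_def f_def g_def dist_commute)
    ultimately have "R\<^sup>2 * ((f * g - k) * (f * g + k)) =
        (g\<^sup>2 / 2)\<^sup>2 * f\<^sup>2 - 2 * (g\<^sup>2 / 2) * (f\<^sup>2 / 2) * k + (f\<^sup>2 / 2)\<^sup>2 * g\<^sup>2"
      using gram[of "x - C"] by metis
    \<comment> \<open>The last factor is \<open>h\<^sup>2\<close> by the law of cosines, so this is
      the squared formula for the circumradius.\<close>
    then have "4 * (R\<^sup>2 * ((f * g - k) * (f * g + k))) = f\<^sup>2 * g\<^sup>2 * (f\<^sup>2 + g\<^sup>2 - 2 * k)"
      by (simp add: power2_eq_square algebra_simps)
    then have "4 * (R\<^sup>2 * ((2 * p * q) * (2 * t * z))) = (f * g * h)\<^sup>2"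
      unfolding k1 k2 hh[symmetric] by (simp add: power_mult_distrib)
    then show ?thesis unfolding z(2-4) by (simp add: mult_ac)
  qed
  have "0 \<le> R" using xd(1) by auto
  with excircle_radius_lt_aux[OF nonneg(1,2) z0 r _ z(1) exc circ] show ?thesis by simp
qed

theorem lemma1:
  fixes A B C cR cr :: "real^2" and R r :: real
  assumes "\<not> collinear {A, B, C}"
    and "is_circumcircle A B C cR R"
    and "is_excircle A B C cr r"
  shows "R / r > 1 / 4"
proof -
  \<comment> \<open>Cyclic relabelling of the vertices reduces the other two excircles to the one at
    \<open>AB\<close>.\<close>
  have rot: "{B, C, A} = {A, B, C}" "{C, A, B} = {A, B, C}" by auto
  have cc: "is_circumcircle B C A cR R" "is_circumcircle C A B cR R"
    using assms(2) unfolding is_circumcircle_def rot by simp_all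
  have nc: "\<not> collinear {B, C, A}" "\<not> collinear {C, A, B}"
    using assms(1) unfolding rot by simp_all
  have "r < 4 * R"
    using assms(3) unfolding is_excircle_def
    using excircle_at_radius_lt[OF assms(1,2)] excircle_at_radius_lt[OF nc(1) cc(1)]
      excircle_at_radius_lt[OF nc(2) cc(2)] by blast
  moreover have "r > 0" using assms(3) by (auto simp: is_excircle_def is_excircle_at_def)
  ultimately show ?thesis by (simp add: field_simps)
qed

end
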